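(* Let $\eta\in(0,1)$, $r>0$ with $\bar\rho:=\eta e^{2r}<1$, let $T(\theta)$ and $b_{\rm vac}$ be as in the context, and consider the recursion $v_t=T(\theta_t)v_{t-1}+b_{\rm vac}$ for real angle sequences $(\theta_t)_{t\le 0}$. **(a) Gauge grading.** With $Q=\mathrm{diag}(1,-1,0)$, for all real $\theta,\chi$: $T(\theta+\chi)=e^{i\chi Q}T(\theta)e^{-i\chi Q}$ and $e^{i\chi Q}b_{\rm vac}=b_{\rm vac}$. In the Laurent decomposition $T(\theta)=\sum_{d}T_de^{id\theta}$ one has $[Q,T_d]=d\,T_d$ for all $d$, $T_d=0$ for $|d|\ge3$, the first row contains no negative frequencies ($e_m^\dagger T_{-1}=e_m^\dagger T_{-2}=0$, $e_m=(1,0,0)^\top$), and $e_m^\dagger T_0=x\,e_m^\dagger$ with $x:=\eta\cosh^2r$. **(b) Contraction.** For every $\theta$, every row of the entrywise absolute value $|T(\theta)|$ sums to $\bar\rho<1$. For every angle sequence the recursion has a unique bounded solution $(v_t)_{t\le0}$; it satisfies $\|v_t\|_\infty\le v_\infty:=\frac{1-\eta}{2(1-\bar\rho)}$, and it has fading memory at rate $\bar\rho$: there is a constant $C$ (independent of the angle sequences and of $t$) such that if two angle sequences agree at all slots later than $t-\ell$ and up to $t$, the corresponding solutions satisfy $\|v_t-v'_t\|_\infty\le C\bar\rho^{\,\ell}$. **(c) Dyson grading.** Put $T_{\rm od}(\theta):=T(\theta)-T_0$ (so all input dependence sits in $T_{\rm od}$) and $\sigma:=\eta(\sinh2r+\sinh^2r)$.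 The bounded solution decomposes as $v_t=\sum_{k\ge0}v_t^{(k)}$, where $v^{(k)}_t$ is the sum of all terms with exactly $k$ factors $T_{\rm od}$ (see context), and for each fixed $k$ and $\eta$, $\|v_t^{(k)}\|_\infty=O(\sigma^k)$ as $r\to 0^+$, uniformly in $t$ and the angles. The first component of grade one is $$m^{(1)}_t=\sum_{j\le t}\varkappa\,x^{t-j}e^{i\theta_j},\qquad \varkappa=-\eta\sinh(2r)\,J_{\rm ss},\qquad J_{\rm ss}=\frac{1-\eta}{2(1-\eta\cosh2r)},$$ and the first component of grade two is $$m^{(2)}_t=\eta\sinh^2r\;\varkappa\sum_{i<j\le t}x^{t-j}\,x^{j-1-i}\,e^{i(2\theta_j-\theta_i)}.$$
   Context: $v_t=(m_t,\bar m_t,J_t)^\top$; $b_{\rm vac}=(0,0,\tfrac{1-\eta}{2})^\top$; $$T(\theta)=\eta\begin{pmatrix}\cosh^2 r& e^{2i\theta}\sinh^2 r&-e^{i\theta}\sinh 2r\\ e^{-2i\theta}\sinh^2 r&\cosh^2 r&-e^{-i\theta}\sinh2r\\ -\tfrac12e^{-i\theta}\sinh2r&-\tfrac12e^{i\theta}\sinh2r&\cosh2r\end{pmatrix}.$$ $T_d$ denotes the coefficient matrix of $e^{id\theta}$ in $T(\theta)$; $T_0=\eta\,\mathrm{diag}(\cosh^2r,\cosh^2r,\cosh2r)$. $\|\cdot\|_\infty$ is the max norm on $\mathbb C^3$. The grade-$k$ part is $$v_t^{(k)}=\sum_{t\ge j_k>\cdots>j_1}T_0^{\,t-j_k}T_{\rm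 od}(\theta_{j_k})T_0^{\,j_k-j_{k-1}-1}\cdots T_{\rm od}(\theta_{j_1})\sum_{\ell\ge0}T_0^{\,\ell}b_{\rm vac},\qquad v^{(0)}_t=\sum_{\ell\ge0}T_0^{\,\ell}b_{\rm vac}.$$ In the paper's model $\theta_t=\varphi_t+\beta s_t$ with a mask phase $\varphi_t$ and input $s_t$; only the angle sequence matters here. *)

theory Defs
  imports "HOL-Analysis.Analysis"
begin

text \<open>The library's \<open>infnorm\<close> on \<open>complex ^ 3\<close> takes real and imaginary parts separately, so the
  max norm of the moduli is defined here.\<close>

definition max_norm :: "complex ^ 'n \<Rightarrow> real" where
  "max_norm v = Max (range (\<lambda>i. norm (v $ i)))"

definition mscale :: "complex \<Rightarrow> complex ^ 'n ^ 'm \<Rightarrow> complex ^ 'n ^ 'm" (infixr \<open>*sm\<close> 75) where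
  "c *sm A = (\<chi> i j. c * A $ i $ j)"

definition diag :: "complex ^ 'n \<Rightarrow> complex ^ 'n ^ 'n" where
  "diag v = (\<chi> i j. if i = j then v $ i else 0)"

text \<open>The type-class operations \<open>*\<close> and \<open>^\<close> on vectors are componentwise, so powers and the
  exponential with respect to the matrix product \<open>**\<close> are introduced explicitly.\<close>

primrec mpow :: "complex ^ 'n ^ 'n \<Rightarrow> nat \<Rightarrow> complex ^ 'n ^ 'n" where
  "mpow A 0 = mat 1"
| "mpow A (Suc n) = A ** mpow A n"

definition mexp :: "complex ^ 'n ^ 'n \<Rightarrow> complex ^ 'n ^ 'n" where
  "mexp A = (\<Sum>n. (1 / fact n) *sm mpow A n)"

definition commutator :: "complex ^ 'n ^ 'n \<Rightarrow> complex ^ 'n ^ 'n \<Rightarrow> complex ^ 'n ^ 'n" where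
  "commutator A B = A ** B - B ** A"

text \<open>\<open>F\<close> is the finitely supported family of coefficients of \<open>e\<^sup>i\<^sup>d\<^sup>\<theta>\<close> in \<open>M \<theta>\<close>.\<close>

definition laurent_decomposition ::
    "(real \<Rightarrow> complex ^ 'n ^ 'n) \<Rightarrow> (int \<Rightarrow> complex ^ 'n ^ 'n) \<Rightarrow> bool" where
  "laurent_decomposition M F \<longleftrightarrow>
     finite {d. F d \<noteq> 0} \<and> (\<forall>\<theta>. M \<theta> = (\<Sum>d | F d \<noteq> 0. cis (of_int d * \<theta>) *sm F d))"

definition Tmat :: "real \<Rightarrow> real \<Rightarrow> real \<Rightarrow> complex ^ 3 ^ 3" where
  "Tmat \<eta> r \<theta> = complex_of_real \<eta> *sm vector
    [vector [of_real ((cosh r)\<^sup>2), cis (2 * \<theta>) * of_real ((sinh r)\<^sup>2), - cis \<theta> * of_real (sinh (2 * r))],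
     vector [cis (- 2 * \<theta>) * of_real ((sinh r)\<^sup>2), of_real ((cosh r)\<^sup>2), - cis (- \<theta>) * of_real (sinh (2 * r))],
     vector [- (1 / 2) * cis (- \<theta>) * of_real (sinh (2 * r)), - (1 / 2) * cis \<theta> * of_real (sinh (2 * r)), of_real (cosh (2 * r))]]"

definition b_vac :: "real \<Rightarrow> complex ^ 3" where
  "b_vac \<eta> = vector [0, 0, of_real ((1 - \<eta>) / 2)]"

definition Qmat :: "complex ^ 3 ^ 3" where
  "Qmat = diag (vector [1, - 1, 0])"

definition Tcoeff :: "real \<Rightarrow> real \<Rightarrow> int \<Rightarrow> complex ^ 3 ^ 3" where
  "Tcoeff \<eta> r = (THE F. laurent_decomposition (Tmat \<eta> r) F)"

text \<open>Sequences indexed by \<open>t \<le> 0\<close> are represented by functions on all of \<open>int\<close> whose values at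
  positive arguments are irrelevant.\<close>

definition bounded_solution :: "real \<Rightarrow> real \<Rightarrow> (int \<Rightarrow> real) \<Rightarrow> (int \<Rightarrow> complex ^ 3) \<Rightarrow> bool" where
  "bounded_solution \<eta> r \<theta> v \<longleftrightarrow>
     (\<forall>t\<le>0. v t = Tmat \<eta> r (\<theta> t) *v v (t - 1) + b_vac \<eta>) \<and>
     (\<exists>B. \<forall>t\<le>0. max_norm (v t) \<le> B)"

definition T_od :: "real \<Rightarrow> real \<Rightarrow> real \<Rightarrow> complex ^ 3 ^ 3" where
  "T_od \<eta> r \<theta> = Tmat \<eta> r \<theta> - Tcoeff \<eta> r 0"

definition v_zero :: "real \<Rightarrow> real \<Rightarrow> complex ^ 3" where
  "v_zero \<eta> r = (\<Sum>l. mpow (Tcoeff \<eta> r 0) l *v b_vac \<eta>)"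

text \<open>The slots are listed from the latest to the earliest, i.e. as \<open>[j\<^sub>k, \<dots>, j\<^sub>1]\<close>; after the slot
  \<open>j\<close> the remaining product is the one belonging to the final time \<open>j - 1\<close>.\<close>

fun dyson_word :: "real \<Rightarrow> real \<Rightarrow> (int \<Rightarrow> real) \<Rightarrow> int \<Rightarrow> int list \<Rightarrow> complex ^ 3 ^ 3" where
  "dyson_word \<eta> r \<theta> t [] = mat 1"
| "dyson_word \<eta> r \<theta> t (j # js) =
     mpow (Tcoeff \<eta> r 0) (nat (t - j)) ** T_od \<eta> r (\<theta> j) ** dyson_word \<eta> r \<theta> (j - 1) js"

definition slots :: "nat \<Rightarrow> int \<Rightarrow> int list set" where
  "slots k t = {js. length js = k \<and> sorted_wrt (>) js \<and> (\<forall>j\<in>set js. j \<le> t)}"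

definition grade :: "real \<Rightarrow> real \<Rightarrow> (int \<Rightarrow> real) \<Rightarrow> nat \<Rightarrow> int \<Rightarrow> complex ^ 3" where
  "grade \<eta> r \<theta> k t = (\<Sum>\<^sub>\<infinity>js\<in>slots k t. dyson_word \<eta> r \<theta> t js *v v_zero \<eta> r)"

definition sigma_od :: "real \<Rightarrow> real \<Rightarrow> real" where
  "sigma_od \<eta> r = \<eta> * (sinh (2 * r) + (sinh r)\<^sup>2)"

definition J_ss :: "real \<Rightarrow> real \<Rightarrow> real" where
  "J_ss \<eta> r = (1 - \<eta>) / (2 * (1 - \<eta> * cosh (2 * r)))"

definition kappa :: "real \<Rightarrow> real \<Rightarrow> real" where
  "kappa \<eta> r = - \<eta> * sinh (2 * r) * J_ss \<eta> r"

end

theory Submission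
  imports Defs
begin

text \<open>Each entry of \<open>T(\<theta>)\<close> is a real amplitude times a single phase determined by the charges on the
  diagonal of \<open>Q\<close>, so gauge covariance and the Laurent coefficients can be read off entrywise, and
  the rows of moduli all sum to \<open>\<rho>\<close>.

  For the Dyson series, row \<open>i\<close> has diagonal part \<open>a\<^sub>i\<close> and off-diagonal absolute sum \<open>\<rho> - a\<^sub>i\<close>.
  Summing the waiting time before the last slot costs a factor \<open>1 / (1 - a\<^sub>i)\<close>, so each further grade
  gains \<open>(\<rho> - a\<^sub>i) / (1 - a\<^sub>i) \<le> \<rho> < 1\<close>. This must be done row by row: the operator norms of \<open>T\<^sub>0\<close> and
  \<open>T\<^sub>o\<^sub>d\<close> may add up to more than 1. Splitting off the words whose last slot is \<open>t\<close> shows that the sum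
  of all grades is a bounded solution, and the contraction makes it the only one.\<close>

section \<open>Max norm and diagonal matrices\<close>

lemma norm_nth_le_max_norm: "norm (v $ i) \<le> max_norm v"
  unfolding max_norm_def by (rule Max_ge) auto

lemma max_norm_le_iff: "max_norm v \<le> B \<longleftrightarrow> (\<forall>i. norm (v $ i) \<le> B)"
  unfolding max_norm_def by (subst Max_le_iff) auto

lemma max_norm_nonneg: "0 \<le> max_norm v"
  using norm_nth_le_max_norm[of v undefined] norm_ge_zero order_trans by blast

lemma diag_nth: "diag v $ i $ j = (if i = j then v $ i else 0)"
  by (simp add: diag_def)

lemma mscale_nth: "(c *sm A) $ i $ j = c * A $ i $ j"
  by (simp add: mscale_def)

lemma diag_mult_vec_nth: "(diag v *v w) $ i = v $ i * w $ i"
  by (simp add: matrix_vector_mult_def diag_nth if_distrib if_distribR cong: if_cong)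

lemma diag_mult_nth: "(diag v ** A) $ i $ j = v $ i * A $ i $ j"
  by (simp add: matrix_matrix_mult_def diag_nth if_distrib if_distribR cong: if_cong)

lemma mult_diag_nth: "(A ** diag v) $ i $ j = A $ i $ j * v $ j"
  by (simp add: matrix_matrix_mult_def diag_nth if_distrib cong: if_cong)

lemma mpow_diag: "mpow (diag v) n = diag (\<chi> i. v $ i ^ n)"
proof (induction n)
  case 0
  then show ?case by (simp add: vec_eq_iff diag_nth mat_def)
next
  case (Suc n)
  then show ?case by (simp add: vec_eq_iff diag_nth diag_mult_nth)
qed

lemma sums_vecI:
  assumes "\<And>i. (\<lambda>n. f n $ i) sums (s $ i)"
  shows "f sums s"
  using assms unfolding sums_def by (intro vec_tendstoI) (simp add: sum_component)

lemma mexp_diag: "mexp (diag v) = diag (\<chi> i. exp (v $ i))"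
proof -
  have "(\<lambda>n. ((1 / fact n) *sm mpow (diag v) n) $ i $ j) sums (diag (\<chi> i. exp (v $ i)) $ i $ j)" for i j
    using exp_converges[of "v $ i"]
    by (auto simp: mscale_nth mpow_diag diag_nth scaleR_conv_of_real divide_simps)
  then have "(\<lambda>n. (1 / fact n) *sm mpow (diag v) n) sums diag (\<chi> i. exp (v $ i))"
    by (intro sums_vecI)
  then show ?thesis
    unfolding mexp_def by (simp add: sums_iff)
qed

text \<open>Allows a fixed matrix to be moved through the infinite sums over slot words and through
  the series over grades.\<close>

lemma bounded_linear_mult_vec: "bounded_linear ((*v) (A :: complex ^ 'n ^ 'm))"
  by (rule linear_conv_bounded_linear[THEN iffD1])
    (auto intro!: linearI simp: vec_eq_iff matrix_vector_mult_def sum.distrib algebra_simps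
      scaleR_sum_right)

lemma norm_le_sum_nth: "norm v \<le> (\<Sum>i\<in>UNIV. norm (v $ i))"
  unfolding norm_vec_def by (rule L2_set_le_sum) auto

section \<open>Uniqueness of Laurent coefficients\<close>

lemma cis_independent:
  fixes c :: "int \<Rightarrow> complex"
  assumes "finite S" "\<And>\<theta>. (\<Sum>d\<in>S. c d * cis (of_int d * \<theta>)) = 0" "d \<in> S"
  shows "c d = 0"
  using assms
proof (induction S arbitrary: c d rule: finite_induct)
  case empty
  then show ?case by simp
next
  case (insert e S)
  have sum0: "c e * cis (of_int e * \<theta>) + (\<Sum>d\<in>S. c d * cis (of_int d * \<theta>)) = 0" for \<theta>
    using insert.prems(1)[of \<theta>] insert.hyps by simp
  \<comment> \<open>Comparing the shift by \<open>\<phi>\<close> with the multiple by \<open>cis (e \<phi>)\<close> removes the frequency \<open>e\<close>.\<close>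
  have "c d * (cis (of_int d * \<phi>) - cis (of_int e * \<phi>)) = 0" if "d \<in> S" for d \<phi>
  proof (rule insert.IH[OF _ that])
    fix \<theta>
    have "(\<Sum>d\<in>S. c d * (cis (of_int d * \<phi>) - cis (of_int e * \<phi>)) * cis (of_int d * \<theta>))
        = (c e * cis (of_int e * (\<theta> + \<phi>)) + (\<Sum>d\<in>S. c d * cis (of_int d * (\<theta> + \<phi>))))
          - cis (of_int e * \<phi>) * (c e * cis (of_int e * \<theta>) + (\<Sum>d\<in>S. c d * cis (of_int d * \<theta>)))"
      by (simp add: algebra_simps sum_distrib_left sum_subtractf flip: cis_mult)
    then show "(\<Sum>d\<in>S. c d * (cis (of_int d * \<phi>) - cis (of_int e * \<phi>)) * cis (of_int d * \<theta>)) = 0"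
      unfolding sum0 by simp
  qed
  \<comment> \<open>This shift makes the two phases differ by exactly \<open>pi\<close>, so they are
    opposite points of the unit circle.\<close>
  moreover have "cis (of_int d * (pi / of_int (d - e))) - cis (of_int e * (pi / of_int (d - e))) \<noteq> 0"
    if "d \<in> S" for d
  proof -
    have "d \<noteq> e" using that insert.hyps by auto
    then have "of_int d * (pi / of_int (d - e)) = of_int e * (pi / of_int (d - e)) + pi"
      by (simp add: field_simps)
    then show ?thesis by (simp flip: cis_mult)
  qed
  ultimately have S0: "c d = 0" if "d \<in> S" for d
    using that by (metis mult_eq_0_iff)
  have "c e = 0" using sum0[of 0] S0 by simp
  with S0 insert.prems(2) show ?case by auto
qed

text \<open>The two supports may differ, so both sums are padded with zero coefficients to the
  union; entry by entry, the differences then vanish by \<open>cis_independent\<close>. This makes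
  the definite description in \<open>Tcoeff\<close> meaningful.\<close>

lemma laurent_decomposition_unique:
  assumes "laurent_decomposition M F" "laurent_decomposition M G"
  shows "F = G"
proof -
  define S where "S = {d. F d \<noteq> 0} \<union> {d. G d \<noteq> 0}"
  have fin: "finite S"
    using assms by (simp add: S_def laurent_decomposition_def)
  have M: "M \<theta> = (\<Sum>d\<in>S. cis (of_int d * \<theta>) *sm H d)"
    if "laurent_decomposition M H" "{d. H d \<noteq> 0} \<subseteq> S" for H \<theta>
  proof -
    have "M \<theta> = (\<Sum>d | H d \<noteq> 0. cis (of_int d * \<theta>) *sm H d)"
      using that by (simp add: laurent_decomposition_def)
    also have "\<dots> = (\<Sum>d\<in>S. cis (of_int d * \<theta>) *sm H d)"
      using that fin by (intro sum.mono_neutral_left) (auto simp: vec_eq_iff mscale_nth)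
    finally show ?thesis .
  qed
  have eq: "(F d - G d) $ i $ j = 0" if "d \<in> S" for d i j
  proof (rule cis_independent[OF fin _ that, of "\<lambda>d. (F d - G d) $ i $ j"])
    fix \<theta>
    have "(\<Sum>d\<in>S. cis (of_int d * \<theta>) *sm F d) $ i $ j = (\<Sum>d\<in>S. cis (of_int d * \<theta>) *sm G d) $ i $ j"
      using M[OF assms(1), of \<theta>] M[OF assms(2), of \<theta>] by (simp add: S_def)
    then show "(\<Sum>d\<in>S. (F d - G d) $ i $ j * cis (of_int d * \<theta>)) = 0"
      by (simp add: sum_component mscale_nth algebra_simps sum_subtractf)
  qed
  show ?thesis
  proof
    fix d
    show "F d = G d"
      using eq[of d] by (cases "d \<in> S") (auto simp: S_def vec_eq_iff)
  qed
qed

section \<open>Entries of the transfer matrix\<close>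

text \<open>The entry \<open>(i, j)\<close> of \<open>T(\<theta>)\<close> is a real amplitude times the phase \<open>e\<^sup>i\<^sup>(\<^sup>q\<^sup>i\<^sup>-\<^sup>q\<^sup>j\<^sup>)\<^sup>\<theta>\<close>, where \<open>q\<close> is the
  diagonal of \<open>Q\<close>.\<close>

definition charge :: "3 \<Rightarrow> int" where
  "charge i = (if i = 1 then 1 else if i = 2 then - 1 else 0)"

definition amp :: "real \<Rightarrow> real \<Rightarrow> 3 \<Rightarrow> 3 \<Rightarrow> real" where
  "amp \<eta> r i j = \<eta> * (if i = j then if i = 3 then cosh (2 * r) else (cosh r)\<^sup>2
     else if j = 3 then - sinh (2 * r) else if i = 3 then - sinh (2 * r) / 2 else (sinh r)\<^sup>2)"

text \<open>Because the charges are distinct, frequency zero selects exactly the diagonal entries.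
  Hence \<open>Tcoeff \<eta> r 0\<close> is diagonal and \<open>T_od\<close> is the off-diagonal
  part of \<open>Tmat\<close>.\<close>

lemma charge_eq_iff: "charge i = charge j \<longleftrightarrow> i = j"
  using exhaust_3[of i] exhaust_3[of j] by (auto simp: charge_def)

lemma Tmat_nth:
  "Tmat \<eta> r \<theta> $ i $ j = of_real (amp \<eta> r i j) * cis (of_int (charge i - charge j) * \<theta>)"
  using exhaust_3[of i] exhaust_3[of j]
  by (auto simp: Tmat_def mscale_nth amp_def charge_def)

lemma Qmat_eq: "Qmat = diag (\<chi> i. of_int (charge i))"
  by (simp add: Qmat_def vec_eq_iff diag_nth forall_3 charge_def)

lemma laurent_decomposition_Tmat:
  "laurent_decomposition (Tmat \<eta> r)
     (\<lambda>d. \<chi> i j. if charge i - charge j = d then of_real (amp \<eta> r i j) else 0)"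
  (is "laurent_decomposition _ ?F")
proof -
  have sub: "{d. ?F d \<noteq> 0} \<subseteq> {-2..2}"
  proof -
    have "\<bar>charge i - charge j\<bar> \<le> 2" for i j by (simp add: charge_def)
    then have "charge i - charge j \<in> {-2..2}" for i j
      using abs_le_iff[of "charge i - charge j" 2] by auto
    then show ?thesis by (auto simp: vec_eq_iff split: if_splits)
  qed
  have "Tmat \<eta> r \<theta> = (\<Sum>d | ?F d \<noteq> 0. cis (of_int d * \<theta>) *sm ?F d)" for \<theta>
  proof -
    \<comment> \<open>Amplitudes can vanish, for instance at \<open>r = 0\<close>, so the sum is
      first evaluated over all possible charge differences and only then cut down to the actual
      support.\<close>
    have "Tmat \<eta> r \<theta> $ i $ j = (\<Sum>d\<in>{-2..2}. cis (of_int d * \<theta>) *sm ?F d) $ i $ j" for i j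
    proof -
      have "charge i - charge j \<in> {-2..2}" by (simp add: charge_def)
      have "(\<Sum>d\<in>{-2..2}. cis (of_int d * \<theta>) *sm ?F d) $ i $ j
          = (\<Sum>d\<in>{-2..2}. if d = charge i - charge j then of_real (amp \<eta> r i j) * cis (of_int d * \<theta>) else 0)"
        unfolding sum_component by (rule sum.cong) (auto simp: mscale_nth)
      also have "\<dots> = Tmat \<eta> r \<theta> $ i $ j"
        using \<open>charge i - charge j \<in> {-2..2}\<close> by (subst sum.delta) (simp_all add: Tmat_nth)
      finally show ?thesis by simp
    qed
    then have "Tmat \<eta> r \<theta> = (\<Sum>d\<in>{-2..2}. cis (of_int d * \<theta>) *sm ?F d)"
      by (simp add: vec_eq_iff)
    also have "\<dots> = (\<Sum>d | ?F d \<noteq> 0. cis (of_int d * \<theta>) *sm ?F d)"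
      using sub by (intro sum.mono_neutral_right) (auto simp: vec_eq_iff mscale_nth)
    finally show ?thesis .
  qed
  moreover have "finite {d. ?F d \<noteq> 0}"
    using sub finite_subset by blast
  ultimately show ?thesis by (simp add: laurent_decomposition_def)
qed

lemma Tcoeff_eq:
  "Tcoeff \<eta> r = (\<lambda>d. \<chi> i j. if charge i - charge j = d then of_real (amp \<eta> r i j) else 0)"
  (is "_ = ?F")
  unfolding Tcoeff_def
proof (rule the_equality)
  show "F = ?F" if "laurent_decomposition (Tmat \<eta> r) F" for F
    using that laurent_decomposition_Tmat by (rule laurent_decomposition_unique)
qed (rule laurent_decomposition_Tmat)

lemma Tcoeff_nth:
  "Tcoeff \<eta> r d $ i $ j = (if charge i - charge j = d then of_real (amp \<eta> r i j) else 0)"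
  by (simp add: Tcoeff_eq)

lemma Tcoeff_0_eq: "Tcoeff \<eta> r 0 = diag (\<chi> i. of_real (amp \<eta> r i i))"
  by (auto simp: vec_eq_iff Tcoeff_nth diag_nth charge_eq_iff)

lemma T_od_nth: "T_od \<eta> r \<theta> $ i $ j = (if i = j then 0 else Tmat \<eta> r \<theta> $ i $ j)"
  by (simp add: T_od_def Tcoeff_0_eq diag_nth Tmat_nth)

lemma mpow_Tcoeff_0_mult_nth:
  "(mpow (Tcoeff \<eta> r 0) n *v w) $ i = of_real (amp \<eta> r i i ^ n) * w $ i"
  by (simp add: Tcoeff_0_eq mpow_diag diag_mult_vec_nth)

lemma Tmat_mult_split: "Tmat \<eta> r \<theta> *v w = Tcoeff \<eta> r 0 *v w + T_od \<eta> r \<theta> *v w"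
  by (simp add: T_od_def matrix_vector_mult_diff_rdistrib)

section \<open>Contraction and the Dyson series\<close>

locale contractive_squeezing =
  fixes \<eta> r :: real
  assumes eta: "0 < \<eta>" "\<eta> < 1"
    and r_pos: "0 < r"
    and contr: "\<eta> * exp (2 * r) < 1"
begin

section \<open>Diagonal and off-diagonal shares of the row sums\<close>

abbreviation \<rho> :: real where "\<rho> \<equiv> \<eta> * exp (2 * r)"

text \<open>The factor by which component \<open>i\<close> decays per time step between two
  slots.\<close>

abbreviation dec :: "3 \<Rightarrow> real" where "dec i \<equiv> amp \<eta> r i i"

definition off :: "3 \<Rightarrow> real" where "off i = (\<Sum>j\<in>UNIV - {i}. \<bar>amp \<eta> r i j\<bar>)"

lemma rho_pos: "0 < \<rho>"
  using eta by simp

lemma dec_pos: "0 < dec i"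
  using eta by (simp add: amp_def)

text \<open>Every row gives \<open>\<eta> * (cosh (2 * r) + sinh (2 * r))\<close>: the first two by
  \<open>cosh (2 * r) = (cosh r)\<^sup>2 + (sinh r)\<^sup>2\<close>, the third because its two
  halves of \<open>sinh (2 * r)\<close> add up. Positivity of \<open>r\<close> resolves the absolute
  values.\<close>

lemma amp_row_sum: "(\<Sum>j\<in>UNIV. \<bar>amp \<eta> r i j\<bar>) = \<rho>"
proof -
  define S C c s where SC: "S = sinh (2 * r)" "C = cosh (2 * r)" "c = (cosh r)\<^sup>2" "s = (sinh r)\<^sup>2"
  have amp: "amp \<eta> r i j = \<eta> * (if i = j then if i = 3 then C else c
     else if j = 3 then - S else if i = 3 then - S / 2 else s)" for i j
    unfolding SC by (rule amp_def)
  have e: "exp (2 * r) = C + S" "C = c + s"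
    unfolding SC using cosh_plus_sinh[of "2 * r"] cosh_double[of r] by linarith+
  have "0 < S" "0 \<le> c" "0 \<le> s"
    using r_pos by (simp_all add: SC)
  then show ?thesis
    unfolding e(1) using exhaust_3[of i] eta e(2)
    by (auto simp: sum_3 amp abs_mult algebra_simps)
qed

lemma off_eq: "off i = \<rho> - dec i"
  using amp_row_sum[of i] dec_pos[of i] by (simp add: off_def sum.remove[of UNIV i])

lemma off_nonneg: "0 \<le> off i"
  by (simp add: off_def sum_nonneg)

lemma dec_le_rho: "dec i \<le> \<rho>"
  using off_nonneg[of i] by (simp add: off_eq)

lemma dec_lt_1: "dec i < 1"
  using dec_le_rho[of i] contr by simp

text \<open>Since \<open>off i = \<rho> - dec i\<close>, this reduces to
  \<open>dec i * \<rho> \<le> dec i\<close>. It licenses the gain \<open>q = \<rho>\<close> per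
  grade, hence convergence in the whole regime \<open>\<rho> < 1\<close>.\<close>

lemma off_le_rho: "off i \<le> \<rho> * (1 - dec i)"
proof -
  have "dec i * \<rho> \<le> dec i * 1"
    using contr dec_pos[of i] by (intro mult_left_mono) auto
  then show ?thesis by (simp add: off_eq algebra_simps)
qed

text \<open>Rows 1 and 2 attain equality; row 3 has the larger diagonal entry
  \<open>\<eta> * cosh (2 * r)\<close> and so less mass off the diagonal.\<close>

lemma off_le_sigma: "off i \<le> sigma_od \<eta> r"
proof -
  have "(cosh r)\<^sup>2 \<le> cosh (2 * r)"
    by (simp add: cosh_double)
  then have "(cosh r)\<^sup>2 \<le> amp \<eta> r i i / \<eta>"
    using eta by (auto simp: amp_def)
  then have "\<eta> * (cosh r)\<^sup>2 \<le> dec i"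
    using eta by (simp add: field_simps)
  moreover have "exp (2 * r) = (cosh r)\<^sup>2 + (sinh r)\<^sup>2 + sinh (2 * r)"
    using cosh_plus_sinh[of "2 * r"] cosh_double[of r] by linarith
  ultimately show ?thesis
    by (simp add: off_eq sigma_od_def algebra_simps)
qed

section \<open>Max-norm contraction, a priori bound, fading memory and uniqueness\<close>

lemma norm_Tmat_mult_nth_le:
  "norm ((Tmat \<eta> r \<theta> *v w) $ i) \<le> \<rho> * max_norm w"
proof -
  have "norm ((Tmat \<eta> r \<theta> *v w) $ i) \<le> (\<Sum>j\<in>UNIV. \<bar>amp \<eta> r i j\<bar> * norm (w $ j))"
    unfolding matrix_vector_mult_def
    by (simp, rule order_trans[OF norm_sum]) (simp add: Tmat_nth norm_mult)
  also have "\<dots> \<le> (\<Sum>j\<in>UNIV. \<bar>amp \<eta> r i j\<bar> * max_norm w)"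
    by (intro sum_mono mult_left_mono norm_nth_le_max_norm) auto
  also have "\<dots> = \<rho> * max_norm w"
    by (simp add: amp_row_sum flip: sum_distrib_right)
  finally show ?thesis .
qed

lemma norm_T_od_mult_nth_le:
  "norm ((T_od \<eta> r \<theta> *v w) $ i) \<le> (\<Sum>j\<in>UNIV - {i}. \<bar>amp \<eta> r i j\<bar> * norm (w $ j))"
proof -
  have "(T_od \<eta> r \<theta> *v w) $ i = (\<Sum>j\<in>UNIV - {i}. T_od \<eta> r \<theta> $ i $ j * w $ j)"
    unfolding matrix_vector_mult_def by (simp add: sum.remove[of UNIV i] T_od_nth)
  also have "norm \<dots> \<le> (\<Sum>j\<in>UNIV - {i}. \<bar>amp \<eta> r i j\<bar> * norm (w $ j))"
    by (rule order_trans[OF norm_sum], rule sum_mono) (auto simp: T_od_nth Tmat_nth norm_mult)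
  finally show ?thesis .
qed

lemma norm_b_vac_nth: "norm (b_vac \<eta> $ i) \<le> (1 - \<eta>) / 2"
  using exhaust_3[of i] eta by (auto simp: b_vac_def norm_divide simp flip: of_real_diff)

text \<open>Unrolling the recursion \<open>n\<close> steps into the past leaves only
  \<open>\<rho> ^ n * B\<close> of an arbitrary bound \<open>B\<close>; the past is infinite, so
  letting \<open>n\<close> grow removes it.\<close>

lemma bounded_solution_bound:
  assumes v: "bounded_solution \<eta> r \<theta> v" and "t \<le> 0"
  shows "max_norm (v t) \<le> (1 - \<eta>) / (2 * (1 - \<rho>))" (is "_ \<le> ?V")
proof -
  obtain B where B: "\<And>t. t \<le> 0 \<Longrightarrow> max_norm (v t) \<le> B"
    using v unfolding bounded_solution_def by blast
  have "0 \<le> B" using B[of 0] max_norm_nonneg[of "v 0"] by simp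
  \<comment> \<open>\<open>?V\<close> is the fixed point of the scalar majorant
    \<open>u \<mapsto> \<rho> * u + (1 - \<eta>) / 2\<close>.\<close>
  have V: "0 \<le> ?V" "\<rho> * ?V + (1 - \<eta>) / 2 = ?V"
    using eta contr by (auto simp: field_simps)
  have "max_norm (v t) \<le> ?V + \<rho> ^ n * B" if "t \<le> 0" for n t
    using that
  proof (induction n arbitrary: t)
    case 0
    then show ?case using B V by fastforce
  next
    case (Suc n)
    have "norm (v t $ i) \<le> ?V + \<rho> ^ Suc n * B" for i
    proof -
      have "v t = Tmat \<eta> r (\<theta> t) *v v (t - 1) + b_vac \<eta>"
        using v Suc.prems unfolding bounded_solution_def by blast
      then have "norm (v t $ i) \<le> norm ((Tmat \<eta> r (\<theta> t) *v v (t - 1)) $ i) + norm (b_vac \<eta> $ i)"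
        by (metis norm_triangle_ineq vector_add_component)
      also have "\<dots> \<le> \<rho> * max_norm (v (t - 1)) + (1 - \<eta>) / 2"
        by (intro add_mono norm_Tmat_mult_nth_le norm_b_vac_nth)
      also have "\<dots> \<le> \<rho> * (?V + \<rho> ^ n * B) + (1 - \<eta>) / 2"
        using Suc rho_pos by (intro add_right_mono mult_left_mono Suc.IH) auto
      also have "\<dots> = ?V + \<rho> ^ Suc n * B"
        using V(2) by (simp add: distrib_left mult.assoc)
      finally show ?thesis .
    qed
    then show ?case by (simp add: max_norm_le_iff)
  qed
  then have "\<forall>n. max_norm (v t) \<le> ?V + \<rho> ^ n * B" using \<open>t \<le> 0\<close> by blast
  moreover have "(\<lambda>n. ?V + \<rho> ^ n * B) \<longlonglongrightarrow> ?V + 0 * B"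
    using rho_pos contr by (intro tendsto_intros LIMSEQ_realpow_zero) auto
  ultimately show ?thesis
    using LIMSEQ_le_const by (metis (lifting) add.right_neutral mult_zero_left)
qed

text \<open>At a slot with equal angles \<open>b_vac\<close> cancels and the difference contracts by
  \<open>\<rho>\<close>. The constant is twice the a priori bound, which controls the difference
  before the shared window.\<close>

lemma fading_memory:
  assumes "bounded_solution \<eta> r \<theta> v" "bounded_solution \<eta> r \<theta>' v'" "t \<le> 0"
    and "\<forall>s. t - int l < s \<and> s \<le> t \<longrightarrow> \<theta> s = \<theta>' s"
  shows "max_norm (v t - v' t) \<le> (1 - \<eta>) / (1 - \<rho>) * \<rho> ^ l"
  using assms(3,4)
proof (induction l arbitrary: t)
  case 0
  have halves: "a / (2 * b) + a / (2 * b) = a / b" for a b :: real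
    by (cases "b = 0") (auto simp: field_simps)
  have "norm ((v t - v' t) $ i) \<le> (1 - \<eta>) / (1 - \<rho>)" for i
  proof -
    have "norm ((v t - v' t) $ i) \<le> norm (v t $ i) + norm (v' t $ i)"
      by (simp add: norm_triangle_ineq4)
    also have "\<dots> \<le> max_norm (v t) + max_norm (v' t)"
      by (intro add_mono norm_nth_le_max_norm)
    also have "\<dots> \<le> (1 - \<eta>) / (2 * (1 - \<rho>)) + (1 - \<eta>) / (2 * (1 - \<rho>))"
      using 0 assms by (intro add_mono bounded_solution_bound)
    also have "\<dots> = (1 - \<eta>) / (1 - \<rho>)"
      by (rule halves)
    finally show ?thesis .
  qed
  then show ?case by (simp add: max_norm_le_iff)
next
  case (Suc l)
  have "v t = Tmat \<eta> r (\<theta> t) *v v (t - 1) + b_vac \<eta>"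
    "v' t = Tmat \<eta> r (\<theta>' t) *v v' (t - 1) + b_vac \<eta>"
    using assms(1,2) Suc.prems unfolding bounded_solution_def by blast+
  moreover have "\<theta> t = \<theta>' t" using Suc.prems by simp
  ultimately have eq: "v t - v' t = Tmat \<eta> r (\<theta> t) *v (v (t - 1) - v' (t - 1))"
    by (simp add: matrix_vector_mult_diff_distrib)
  have "max_norm (v t - v' t) \<le> \<rho> * max_norm (v (t - 1) - v' (t - 1))"
    unfolding eq max_norm_le_iff by (intro allI norm_Tmat_mult_nth_le)
  also have "\<dots> \<le> \<rho> * ((1 - \<eta>) / (1 - \<rho>) * \<rho> ^ l)"
    using Suc rho_pos by (intro mult_left_mono Suc.IH) auto
  finally show ?case by (simp add: mult_ac)
qed

text \<open>Identical angle sequences agree on windows of every length, so the fading-memory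
  estimate holds for all \<open>n\<close> at once.\<close>

lemma bounded_solution_unique:
  assumes "bounded_solution \<eta> r \<theta> v" "bounded_solution \<eta> r \<theta> w" "t \<le> 0"
  shows "w t = v t"
proof -
  have "\<forall>n. max_norm (w t - v t) \<le> (1 - \<eta>) / (1 - \<rho>) * \<rho> ^ n"
    using fading_memory[OF assms(2,1,3)] by blast
  moreover have "(\<lambda>n. (1 - \<eta>) / (1 - \<rho>) * \<rho> ^ n) \<longlonglongrightarrow> (1 - \<eta>) / (1 - \<rho>) * 0"
    using rho_pos contr by (intro tendsto_intros LIMSEQ_realpow_zero) auto
  ultimately have "max_norm (w t - v t) \<le> 0"
    using LIMSEQ_le_const by (metis (lifting) mult_zero_right)
  then show ?thesis by (simp add: max_norm_le_iff vec_eq_iff)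
qed

section \<open>Grade zero as the stationary state of the diagonal part\<close>

lemma v_zero_sums:
  "(\<lambda>l. mpow (Tcoeff \<eta> r 0) l *v b_vac \<eta>) sums vector [0, 0, of_real (J_ss \<eta> r)]"
proof (rule sums_vecI)
  fix i :: 3
  have dec_3: "dec 3 = \<eta> * cosh (2 * r)" by (simp add: amp_def)
  \<comment> \<open>Only the third component of \<open>b_vac\<close> is nonzero, so a single
    geometric series remains.\<close>
  have "(\<lambda>l. dec 3 ^ l * ((1 - \<eta>) / 2)) sums (1 / (1 - dec 3) * ((1 - \<eta>) / 2))"
    using dec_pos[of 3] dec_lt_1[of 3] by (intro sums_mult2 geometric_sums) auto
  also have "1 / (1 - dec 3) * ((1 - \<eta>) / 2) = J_ss \<eta> r"
    by (simp only: dec_3 J_ss_def times_divide_times_eq mult_1_left mult.commute)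
  finally have "(\<lambda>l. complex_of_real (dec 3 ^ l * ((1 - \<eta>) / 2))) sums of_real (J_ss \<eta> r)"
    by (rule sums_of_real)
  then show "(\<lambda>l. (mpow (Tcoeff \<eta> r 0) l *v b_vac \<eta>) $ i) sums (vector [0, 0, of_real (J_ss \<eta> r)] $ i)"
    using exhaust_3[of i] unfolding mpow_Tcoeff_0_mult_nth by (auto simp: b_vac_def)
qed

lemma v_zero_eq: "v_zero \<eta> r = vector [0, 0, of_real (J_ss \<eta> r)]"
  unfolding v_zero_def using v_zero_sums by (simp add: sums_iff)

lemma J_ss_nonneg: "0 \<le> J_ss \<eta> r"
  using dec_lt_1[of 3] eta by (simp add: J_ss_def amp_def)

lemma norm_v_zero_nth: "norm (v_zero \<eta> r $ i) \<le> J_ss \<eta> r"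
  using exhaust_3[of i] J_ss_nonneg by (auto simp: v_zero_eq)

lemma v_zero_fixed: "v_zero \<eta> r = Tcoeff \<eta> r 0 *v v_zero \<eta> r + b_vac \<eta>"
proof -
  have "J_ss \<eta> r = dec 3 * J_ss \<eta> r + (1 - \<eta>) / 2"
    using dec_lt_1[of 3] by (simp add: J_ss_def amp_def field_simps)
  then have "complex_of_real (J_ss \<eta> r) = of_real (dec 3) * of_real (J_ss \<eta> r) + of_real ((1 - \<eta>) / 2)"
    by (metis of_real_add of_real_mult)
  then show ?thesis
    by (simp add: vec_eq_iff forall_3 Tcoeff_0_eq diag_mult_vec_nth v_zero_eq b_vac_def)
qed

section \<open>Slot words and their absolute summability\<close>

definition term_vec :: "(int \<Rightarrow> real) \<Rightarrow> int \<Rightarrow> int list \<Rightarrow> complex ^ 3" where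
  "term_vec \<theta> t js = dyson_word \<eta> r \<theta> t js *v v_zero \<eta> r"

lemma term_vec_Nil: "term_vec \<theta> t [] = v_zero \<eta> r"
  by (simp add: term_vec_def)

lemma term_vec_Cons:
  "term_vec \<theta> t (j # js) =
     mpow (Tcoeff \<eta> r 0) (nat (t - j)) *v (T_od \<eta> r (\<theta> j) *v term_vec \<theta> (j - 1) js)"
  by (simp add: term_vec_def matrix_vector_mul_assoc matrix_mul_assoc)

lemma slots_0: "slots 0 t = {[]}"
  by (auto simp: slots_def)

lemma Cons_in_slots: "j # js \<in> slots (Suc k) t \<longleftrightarrow> j \<le> t \<and> js \<in> slots k (j - 1)"
  by (auto simp: slots_def)

text \<open>A case split on whether the final time is itself a slot; it turns the sum over words
  into a recursion in \<open>t\<close>.\<close>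

lemma slots_Suc: "slots (Suc k) t = (#) t ` slots k (t - 1) \<union> slots (Suc k) (t - 1)"
proof -
  have "js \<in> slots (Suc k) t \<longleftrightarrow> js \<in> (#) t ` slots k (t - 1) \<union> slots (Suc k) (t - 1)" for js
  proof (cases js)
    case Nil
    then show ?thesis by (auto simp: slots_def)
  next
    case (Cons j ks)
    then show ?thesis by (auto simp: Cons_in_slots)
  qed
  then show ?thesis by blast
qed

text \<open>The total weight of all waiting times after the last slot: reindexing by the delay
  \<open>t - j\<close> gives part of a geometric series.\<close>

lemma sum_power_dec_le:
  assumes "finite H" "H \<subseteq> {..t}"
  shows "(\<Sum>j\<in>H. dec i ^ nat (t - j)) \<le> 1 / (1 - dec i)"
proof -
  have inj: "inj_on (\<lambda>j. nat (t - j)) H"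
  proof (rule inj_onI)
    fix x y assume "x \<in> H" "y \<in> H" "nat (t - x) = nat (t - y)"
    moreover from this have "x \<le> t" "y \<le> t" using assms(2) by auto
    ultimately show "x = y" by simp
  qed
  have "(\<Sum>j\<in>H. dec i ^ nat (t - j)) = (\<Sum>n\<in>(\<lambda>j. nat (t - j)) ` H. dec i ^ n)"
    using inj by (simp add: sum.reindex)
  also have "\<dots> \<le> (\<Sum>n. dec i ^ n)"
    using assms(1) dec_pos[of i] dec_lt_1[of i] by (intro sum_le_suminf summable_geometric) auto
  also have "\<dots> = 1 / (1 - dec i)"
    using dec_pos[of i] dec_lt_1[of i] by (intro suminf_geometric) auto
  finally show ?thesis .
qed

text \<open>The gain \<open>q\<close> stays free because it is used twice, as \<open>\<rho>\<close>
  for convergence and as a multiple of \<open>sigma_od\<close> for small \<open>r\<close>. The bound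
  is the same for all components and final times, so the induction hypothesis covers the tails
  ending at \<open>j - 1\<close> in every component.\<close>

lemma sum_term_vec_le:
  assumes q: "\<And>i. off i \<le> q * (1 - dec i)" "0 \<le> q"
    and "finite F" "F \<subseteq> slots k t"
  shows "(\<Sum>js\<in>F. norm (term_vec \<theta> t js $ i)) \<le> J_ss \<eta> r * q ^ k"
  using assms(3,4)
proof (induction k arbitrary: t F i)
  case 0
  then have "F = {} \<or> F = {[]}" by (auto simp: slots_0)
  then show ?case using norm_v_zero_nth J_ss_nonneg by (auto simp: term_vec_Nil)
next
  case (Suc k)
  let ?M = "J_ss \<eta> r * q ^ k"
  have M: "0 \<le> ?M" using J_ss_nonneg q(2) by simp
  define tails where "tails j = {js. j # js \<in> F}" for j
  have shape: "\<exists>j ks. js = j # ks \<and> j \<le> t" if "js \<in> F" for js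
    using that Suc.prems(2) by (cases js) (auto simp: slots_def)
  have fin: "finite (tails j)" for j
    unfolding tails_def using finite_vimageI[OF Suc.prems(1), of "(#) j"] by (simp add: vimage_def)
  have sub: "tails j \<subseteq> slots k (j - 1)" for j
    using Suc.prems(2) by (auto simp: tails_def Cons_in_slots)
  have H: "finite (hd ` F)" "hd ` F \<subseteq> {..t}"
    using Suc.prems(1) shape by fastforce+
  \<comment> \<open>The words are grouped by their latest slot, which makes the sum an iterated
    one.\<close>
  have F: "F = (\<lambda>(j, js). j # js) ` Sigma (hd ` F) tails"
  proof
    show "F \<subseteq> (\<lambda>(j, js). j # js) ` Sigma (hd ` F) tails"
    proof
      fix js assume "js \<in> F"
      with shape obtain j ks where "js = j # ks" by blast
      with \<open>js \<in> F\<close> have "(j, ks) \<in> Sigma (hd ` F) tails"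
        by (force simp: tails_def)
      then show "js \<in> (\<lambda>(j, js). j # js) ` Sigma (hd ` F) tails"
        using \<open>js = j # ks\<close> by (intro image_eqI[of _ _ "(j, ks)"]) auto
    qed
  qed (auto simp: tails_def)
  have "(\<Sum>js\<in>F. norm (term_vec \<theta> t js $ i))
      = (\<Sum>(j, js)\<in>Sigma (hd ` F) tails. norm (term_vec \<theta> t (j # js) $ i))"
    by (subst F, subst sum.reindex) (auto simp: inj_on_def case_prod_unfold)
  also have "\<dots> = (\<Sum>j\<in>hd ` F. \<Sum>js\<in>tails j. norm (term_vec \<theta> t (j # js) $ i))"
    using H(1) fin by (subst sum.Sigma) auto
  \<comment> \<open>For a fixed latest slot, the waiting factor is exact, the row of
    \<open>T_od\<close> costs \<open>off i\<close>, and the tails cost \<open>?M\<close>.\<close>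
  also have "\<dots> \<le> (\<Sum>j\<in>hd ` F. dec i ^ nat (t - j) * (off i * ?M))"
  proof (rule sum_mono)
    fix j
    have "(\<Sum>js\<in>tails j. norm (term_vec \<theta> t (j # js) $ i))
        = dec i ^ nat (t - j) * (\<Sum>js\<in>tails j. norm ((T_od \<eta> r (\<theta> j) *v term_vec \<theta> (j - 1) js) $ i))"
      using dec_pos[of i]
      by (simp add: term_vec_Cons mpow_Tcoeff_0_mult_nth norm_mult norm_power sum_distrib_left)
    also have "(\<Sum>js\<in>tails j. norm ((T_od \<eta> r (\<theta> j) *v term_vec \<theta> (j - 1) js) $ i))
        \<le> (\<Sum>js\<in>tails j. \<Sum>l\<in>UNIV - {i}. \<bar>amp \<eta> r i l\<bar> * norm (term_vec \<theta> (j - 1) js $ l))"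
      by (intro sum_mono norm_T_od_mult_nth_le)
    also have "\<dots> = (\<Sum>l\<in>UNIV - {i}. \<bar>amp \<eta> r i l\<bar> * (\<Sum>js\<in>tails j. norm (term_vec \<theta> (j - 1) js $ l)))"
      by (subst sum.swap) (simp add: sum_distrib_left)
    also have "\<dots> \<le> (\<Sum>l\<in>UNIV - {i}. \<bar>amp \<eta> r i l\<bar> * ?M)"
      by (intro sum_mono mult_left_mono Suc.IH[OF fin sub]) auto
    also have "\<dots> = off i * ?M"
      by (simp only: off_def sum_distrib_right)
    finally show "(\<Sum>js\<in>tails j. norm (term_vec \<theta> t (j # js) $ i)) \<le> dec i ^ nat (t - j) * (off i * ?M)"
      using dec_pos[of i] by simp
  qed
  also have "\<dots> = (\<Sum>j\<in>hd ` F. dec i ^ nat (t - j)) * (off i * ?M)"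
    by (simp only: sum_distrib_right)
  \<comment> \<open>The waiting-time factor cancels against \<open>1 - dec i\<close> in the bound on
    \<open>off i\<close>, leaving precisely one factor \<open>q\<close>.\<close>
  also have "\<dots> \<le> 1 / (1 - dec i) * (q * (1 - dec i) * ?M)"
    using M off_nonneg[of i] dec_lt_1[of i] q
    by (intro mult_mono sum_power_dec_le[OF H] mult_right_mono) auto
  also have "\<dots> = J_ss \<eta> r * q ^ Suc k"
    using dec_lt_1[of i] by (simp add: field_simps)
  finally show ?case .
qed

lemma abs_summable_term_vec_nth: "(\<lambda>js. norm (term_vec \<theta> t js $ i)) summable_on slots k t"
proof (rule nonneg_bdd_above_summable_on)
  show "bdd_above (sum (\<lambda>js. norm (term_vec \<theta> t js $ i)) ` {F. F \<subseteq> slots k t \<and> finite F})"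
    using sum_term_vec_le[OF off_le_rho] rho_pos
    by (intro bdd_aboveI2[where M = "J_ss \<eta> r * \<rho> ^ k"]) auto
qed auto

lemma summable_term_vec: "term_vec \<theta> t summable_on slots k t"
proof (rule abs_summable_summable)
  have "(\<lambda>js. \<Sum>i\<in>UNIV. norm (term_vec \<theta> t js $ i)) summable_on slots k t"
    by (simp only: sum_3) (intro summable_on_add abs_summable_term_vec_nth)
  then show "(\<lambda>js. norm (term_vec \<theta> t js)) summable_on slots k t"
    by (rule summable_on_comparison_test) (auto intro: norm_le_sum_nth)
qed

lemma has_sum_grade: "(term_vec \<theta> t has_sum grade \<eta> r \<theta> k t) (slots k t)"
  using summable_term_vec unfolding grade_def term_vec_def by (simp add: has_sum_infsum)

lemma has_sum_grade_nth:
  "((\<lambda>js. term_vec \<theta> t js $ i) has_sum grade \<eta> r \<theta> k t $ i) (slots k t)"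
  using has_sum_bounded_linear[OF bounded_linear_vec_nth has_sum_grade] .

lemma norm_grade_nth_le:
  assumes q: "\<And>i. off i \<le> q * (1 - dec i)" "0 \<le> q"
  shows "norm (grade \<eta> r \<theta> k t $ i) \<le> J_ss \<eta> r * q ^ k"
proof -
  have "norm (grade \<eta> r \<theta> k t $ i) \<le> (\<Sum>\<^sub>\<infinity>js\<in>slots k t. norm (term_vec \<theta> t js $ i))"
    using norm_infsum_bound[OF abs_summable_term_vec_nth] infsumI[OF has_sum_grade_nth] by metis
  also have "\<dots> \<le> J_ss \<eta> r * q ^ k"
    by (intro infsum_le_finite_sums abs_summable_term_vec_nth sum_term_vec_le q)
  finally show ?thesis .
qed

section \<open>Recursion in the grade and the Dyson sum as a bounded solution\<close>

lemma grade_0: "grade \<eta> r \<theta> 0 t = v_zero \<eta> r"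
  by (simp add: grade_def slots_0)

text \<open>Words whose latest slot is \<open>t\<close> contribute \<open>T_od\<close> applied to
  the lower grade; all others already occur at \<open>t - 1\<close> and gain one diagonal factor.
  Both sides are sums of the same family, so they coincide.\<close>

lemma grade_Suc:
  "grade \<eta> r \<theta> (Suc k) t =
     Tcoeff \<eta> r 0 *v grade \<eta> r \<theta> (Suc k) (t - 1) + T_od \<eta> r (\<theta> t) *v grade \<eta> r \<theta> k (t - 1)"
proof (rule infsumI[OF has_sum_grade, symmetric, THEN trans], rule infsumI)
  have "((\<lambda>js. T_od \<eta> r (\<theta> t) *v term_vec \<theta> (t - 1) js) has_sum
      T_od \<eta> r (\<theta> t) *v grade \<eta> r \<theta> k (t - 1)) (slots k (t - 1))"
    by (intro has_sum_bounded_linear[OF bounded_linear_mult_vec] has_sum_grade)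
  moreover have "(\<lambda>js. T_od \<eta> r (\<theta> t) *v term_vec \<theta> (t - 1) js) = term_vec \<theta> t \<circ> (#) t"
    by (auto simp: term_vec_Cons)
  ultimately have 1: "(term_vec \<theta> t has_sum T_od \<eta> r (\<theta> t) *v grade \<eta> r \<theta> k (t - 1))
      ((#) t ` slots k (t - 1))"
    by (subst has_sum_reindex) (auto simp: inj_on_def)
  have shifted: "((\<lambda>js. Tcoeff \<eta> r 0 *v term_vec \<theta> (t - 1) js) has_sum
      Tcoeff \<eta> r 0 *v grade \<eta> r \<theta> (Suc k) (t - 1)) (slots (Suc k) (t - 1))"
    by (intro has_sum_bounded_linear[OF bounded_linear_mult_vec] has_sum_grade)
  have step: "Tcoeff \<eta> r 0 *v term_vec \<theta> (t - 1) js = term_vec \<theta> t js"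
    if "js \<in> slots (Suc k) (t - 1)" for js
  proof (cases js)
    case Nil
    then show ?thesis using that by (simp add: slots_def)
  next
    case (Cons j ks)
    \<comment> \<open>Here \<open>j \<le> t - 1\<close>, so \<open>nat\<close> does not truncate and
      the exponent grows by exactly one.\<close>
    then have "nat (t - j) = Suc (nat (t - 1 - j))" using that by (auto simp: Cons_in_slots)
    then show ?thesis by (simp add: Cons term_vec_Cons matrix_vector_mul_assoc matrix_mul_assoc)
  qed
  have 2: "(term_vec \<theta> t has_sum Tcoeff \<eta> r 0 *v grade \<eta> r \<theta> (Suc k) (t - 1))
      (slots (Suc k) (t - 1))"
    using shifted has_sum_cong[OF step] by (rule iffD1[rotated])
  show "(term_vec \<theta> t has_sum Tcoeff \<eta> r 0 *v grade \<eta> r \<theta> (Suc k) (t - 1)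
      + T_od \<eta> r (\<theta> t) *v grade \<eta> r \<theta> k (t - 1)) (slots (Suc k) t)"
    unfolding slots_Suc[of k t]
    by (subst add.commute, rule has_sum_Un_disjoint[OF 1 2]) (auto simp: Cons_in_slots)
qed

lemma summable_grade: "summable (\<lambda>k. grade \<eta> r \<theta> k t)"
proof (rule summable_comparison_test')
  show "summable (\<lambda>k. 3 * (J_ss \<eta> r * \<rho> ^ k))"
    using rho_pos contr by (intro summable_mult summable_geometric) auto
  fix k
  have "norm (grade \<eta> r \<theta> k t) \<le> (\<Sum>i\<in>UNIV. norm (grade \<eta> r \<theta> k t $ i))"
    by (rule norm_le_sum_nth)
  also have "\<dots> \<le> (\<Sum>i\<in>(UNIV :: 3 set). J_ss \<eta> r * \<rho> ^ k)"
    using rho_pos by (intro sum_mono norm_grade_nth_le off_le_rho) auto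
  finally show "norm (grade \<eta> r \<theta> k t) \<le> 3 * (J_ss \<eta> r * \<rho> ^ k)" by simp
qed

text \<open>In the sum of \<open>grade_Suc\<close> over \<open>k\<close> the diagonal part acts on
  all grades except zero, while \<open>T_od\<close> acts on all of them. The missing diagonal
  contribution and \<open>b_vac\<close> both come from \<open>v_zero_fixed\<close>.\<close>

lemma bounded_solution_dyson: "bounded_solution \<eta> r \<theta> (\<lambda>t. \<Sum>k. grade \<eta> r \<theta> k t)"
proof -
  let ?v = "\<lambda>t. \<Sum>k. grade \<eta> r \<theta> k t"
  have "?v t = Tmat \<eta> r (\<theta> t) *v ?v (t - 1) + b_vac \<eta>" for t
  proof -
    have s: "(\<lambda>k. grade \<eta> r \<theta> k (t - 1)) sums ?v (t - 1)"
      by (rule summable_sums[OF summable_grade])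
    then have "(\<lambda>k. grade \<eta> r \<theta> (Suc k) (t - 1)) sums (?v (t - 1) - v_zero \<eta> r)"
      by (subst sums_Suc_iff) (simp add: grade_0)
    then have "(\<lambda>k. grade \<eta> r \<theta> (Suc k) t) sums
        (Tcoeff \<eta> r 0 *v (?v (t - 1) - v_zero \<eta> r) + T_od \<eta> r (\<theta> t) *v ?v (t - 1))"
      unfolding grade_Suc[of \<theta> _ t]
      by (intro sums_add bounded_linear.sums[OF bounded_linear_mult_vec] s)
    then have "(\<lambda>k. grade \<eta> r \<theta> k t) sums
        (Tcoeff \<eta> r 0 *v (?v (t - 1) - v_zero \<eta> r) + T_od \<eta> r (\<theta> t) *v ?v (t - 1) + v_zero \<eta> r)"
      by (subst (asm) sums_Suc_iff) (simp add: grade_0)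
    also have "Tcoeff \<eta> r 0 *v (?v (t - 1) - v_zero \<eta> r) + T_od \<eta> r (\<theta> t) *v ?v (t - 1) + v_zero \<eta> r
        = Tmat \<eta> r (\<theta> t) *v ?v (t - 1) + b_vac \<eta>"
      by (subst (2) v_zero_fixed) (simp add: Tmat_mult_split matrix_vector_mult_diff_distrib)
    finally show ?thesis by (simp add: sums_iff)
  qed
  moreover have "max_norm (?v t) \<le> (\<Sum>k. J_ss \<eta> r * \<rho> ^ k)" for t
  proof -
    have "norm (?v t $ i) \<le> (\<Sum>k. J_ss \<eta> r * \<rho> ^ k)" for i
    proof -
      have g: "summable (\<lambda>k. J_ss \<eta> r * \<rho> ^ k)"
        using rho_pos contr by (intro summable_mult summable_geometric) auto
      have "?v t $ i = (\<Sum>k. grade \<eta> r \<theta> k t $ i)"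
        using bounded_linear.suminf[OF bounded_linear_vec_nth summable_grade] by metis
      also have "norm \<dots> \<le> (\<Sum>k. J_ss \<eta> r * \<rho> ^ k)"
        using g rho_pos by (intro norm_suminf_le norm_grade_nth_le off_le_rho) auto
      finally show ?thesis .
    qed
    then show ?thesis by (simp add: max_norm_le_iff)
  qed
  ultimately show ?thesis
    unfolding bounded_solution_def by blast
qed

section \<open>Closed forms for grades one and two\<close>

lemma T_od_v_zero_nth:
  "(T_od \<eta> r \<theta> *v v_zero \<eta> r) $ 1 = of_real (kappa \<eta> r) * cis \<theta>"
  "(T_od \<eta> r \<theta> *v v_zero \<eta> r) $ 2 = of_real (kappa \<eta> r) * cis (- \<theta>)"
  "(T_od \<eta> r \<theta> *v v_zero \<eta> r) $ 3 = 0"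
  by (simp_all add: matrix_vector_mult_def sum_3 T_od_nth Tmat_nth v_zero_eq amp_def charge_def kappa_def)

lemma T_od_mult_nth_1:
  "(T_od \<eta> r \<theta> *v w) $ 1 =
     of_real (\<eta> * (sinh r)\<^sup>2) * cis (2 * \<theta>) * w $ 2 - of_real (\<eta> * sinh (2 * r)) * cis \<theta> * w $ 3"
  by (simp add: matrix_vector_mult_def sum_3 T_od_nth Tmat_nth amp_def charge_def)

lemma has_sum_grade_1:
  "((\<lambda>j. of_real (kappa \<eta> r * dec 1 ^ nat (t - j)) * cis (\<theta> j)) has_sum grade \<eta> r \<theta> 1 t $ 1) {..t}"
proof -
  have "js \<in> slots 1 t \<longleftrightarrow> js \<in> (\<lambda>j. [j]) ` {..t}" for js
    by (cases js) (auto simp: Cons_in_slots slots_0, auto simp: slots_def)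
  then have sl: "slots 1 t = (\<lambda>j. [j]) ` {..t}" by blast
  have "((\<lambda>js. term_vec \<theta> t js $ 1) \<circ> (\<lambda>j. [j]) has_sum grade \<eta> r \<theta> 1 t $ 1) {..t}"
    using has_sum_grade_nth[of \<theta> t 1 1] unfolding sl
    by (subst (asm) has_sum_reindex) (auto simp: inj_on_def)
  then show ?thesis
    by (simp add: o_def term_vec_Cons term_vec_Nil mpow_Tcoeff_0_mult_nth T_od_v_zero_nth mult_ac)
qed

text \<open>\<open>v_zero\<close> lies on the third axis and the first \<open>T_od\<close> leaves no
  third component, so the only path into component 1 with two off-diagonal steps is 3 to 2 to 1. The
  wait between the slots takes place in component 2, which decays at the same rate as component
  1.\<close>

lemma has_sum_grade_2:
  "((\<lambda>(i, j). of_real (\<eta> * (sinh r)\<^sup>2 * kappa \<eta> r * dec 1 ^ nat (t - j) * dec 1 ^ nat (j - 1 - i))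
       * cis (2 * \<theta> j - \<theta> i)) has_sum grade \<eta> r \<theta> 2 t $ 1) {(i, j). i < j \<and> j \<le> t}"
proof -
  let ?w = "\<lambda>(i, j). [j, i]"
  have "js \<in> slots 2 t \<longleftrightarrow> js \<in> ?w ` {(i, j). i < j \<and> j \<le> t}" for js
  proof
    assume "js \<in> slots 2 t"
    then obtain j i where "js = [j, i]" "i < j" "j \<le> t"
      by (auto simp: slots_def numeral_2_eq_2 length_Suc_conv)
    then show "js \<in> ?w ` {(i, j). i < j \<and> j \<le> t}" by force
  qed (auto simp: slots_def)
  then have sl: "slots 2 t = ?w ` {(i, j). i < j \<and> j \<le> t}" by blast
  have "((\<lambda>js. term_vec \<theta> t js $ 1) \<circ> ?w has_sum grade \<eta> r \<theta> 2 t $ 1) {(i, j). i < j \<and> j \<le> t}"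
    using has_sum_grade_nth[of \<theta> t 1 2] unfolding sl
    by (subst (asm) has_sum_reindex) (auto simp: inj_on_def)
  moreover have "((\<lambda>js. term_vec \<theta> t js $ 1) \<circ> ?w) (i, j) =
      of_real (\<eta> * (sinh r)\<^sup>2 * kappa \<eta> r * dec 1 ^ nat (t - j) * dec 1 ^ nat (j - 1 - i))
       * cis (2 * \<theta> j - \<theta> i)" for i j
  proof -
    have "amp \<eta> r 2 2 = amp \<eta> r 1 1" by (simp add: amp_def)
    moreover have "cis (2 * \<theta> j - \<theta> i) = cis (2 * \<theta> j) * cis (- \<theta> i)"
      by (simp add: cis_mult)
    ultimately show ?thesis
      by (simp add: term_vec_Cons term_vec_Nil mpow_Tcoeff_0_mult_nth T_od_mult_nth_1 T_od_v_zero_nth mult_ac)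
  qed
  ultimately show ?thesis
    by (elim has_sum_cong[THEN iffD1, rotated]) auto
qed

end

section \<open>Grade bounds for small squeezing\<close>

lemma grade_bound_sigma:
  fixes \<eta> :: real
  assumes "0 < \<eta>" "\<eta> < 1"
  shows "\<exists>C. \<forall>\<^sub>F r in at_right 0. \<forall>\<theta> t. max_norm (grade \<eta> r \<theta> k t) \<le> C * sigma_od \<eta> r ^ k"
proof (intro exI)
  \<comment> \<open>At \<open>r = 0\<close> every \<open>1 - dec i\<close> equals
    \<open>1 - \<eta>\<close>; half of this survives as a uniform gap for small \<open>r\<close>.
    Then \<open>q = sigma_od \<eta> r / ?d\<close> is admissible, and the constant
    \<open>1 / ?d ^ k\<close> depends only on \<open>\<eta>\<close> and \<open>k\<close>.\<close>
  let ?d = "(1 - \<eta>) / 2"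
  have "((\<lambda>r. \<eta> * exp (2 * r)) \<longlongrightarrow> \<eta> * exp (2 * 0)) (at_right 0)"
    by (intro tendsto_intros)
  then have "\<forall>\<^sub>F r in at_right 0. \<eta> * exp (2 * r) < 1 - ?d"
    using assms by (intro order_tendstoD) (auto simp: field_simps)
  moreover have "\<forall>\<^sub>F r in at_right (0 :: real). 0 < r"
    by (rule eventually_at_right_less)
  ultimately show "\<forall>\<^sub>F r in at_right 0. \<forall>\<theta> t.
      max_norm (grade \<eta> r \<theta> k t) \<le> 1 / ?d ^ k * sigma_od \<eta> r ^ k"
  proof eventually_elim
    case (elim r)
    have "1 - ?d < 1" using assms by simp
    with elim(1) have "\<eta> * exp (2 * r) < 1" by (rule less_trans)
    then interpret contractive_squeezing \<eta> r
      using assms elim by unfold_locales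
    have gap: "?d \<le> 1 - dec i" for i
      using le_less_trans[OF dec_le_rho[of i] elim(1)] by linarith
    have "?d \<le> 1 - dec 3" by (rule gap)
    \<comment> \<open>\<open>J_ss \<eta> r\<close> equals \<open>?d / (1 - dec 3)\<close>, so the
      gap in row 3 bounds it by 1.\<close>
    then have J: "J_ss \<eta> r \<le> 1"
      using dec_lt_1[of 3] by (simp add: J_ss_def amp_def field_simps)
    have s: "0 \<le> sigma_od \<eta> r"
      using off_le_sigma off_nonneg order_trans by blast
    have q: "off i \<le> sigma_od \<eta> r / ?d * (1 - dec i)" for i
    proof -
      have "off i \<le> sigma_od \<eta> r / ?d * ?d"
        using off_le_sigma assms by simp
      also have "\<dots> \<le> sigma_od \<eta> r / ?d * (1 - dec i)"
        using gap s assms by (intro mult_left_mono) auto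
      finally show ?thesis .
    qed
    show ?case
    proof (intro allI, unfold max_norm_le_iff, intro allI)
      fix \<theta> t i
      have "norm (grade \<eta> r \<theta> k t $ i) \<le> J_ss \<eta> r * (sigma_od \<eta> r / ?d) ^ k"
        using s assms by (intro norm_grade_nth_le q) auto
      also have "\<dots> \<le> 1 * (sigma_od \<eta> r / ?d) ^ k"
        using J s assms by (intro mult_right_mono) auto
      finally show "norm (grade \<eta> r \<theta> k t $ i) \<le> 1 / ?d ^ k * sigma_od \<eta> r ^ k"
        by (simp add: power_divide mult.commute)
    qed
  qed
qed

section \<open>Gauge grading, contraction and Dyson grading combined\<close>

theorem lemma1:
  fixes \<eta> r \<rho> x :: real
  assumes "0 < \<eta>" "\<eta> < 1" "0 < r"
    and rho: "\<rho> = \<eta> * exp (2 * r)" "\<rho> < 1"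
    and x: "x = \<eta> * (cosh r)\<^sup>2"
  shows
    "((\<forall>\<theta> \<phi>. Tmat \<eta> r (\<theta> + \<phi>) =
        mexp ((\<i> * of_real \<phi>) *sm Qmat) ** Tmat \<eta> r \<theta> ** mexp ((- \<i> * of_real \<phi>) *sm Qmat))
   \<and> (\<forall>\<phi>. mexp ((\<i> * of_real \<phi>) *sm Qmat) *v b_vac \<eta> = b_vac \<eta>)
   \<and> laurent_decomposition (Tmat \<eta> r) (Tcoeff \<eta> r)
   \<and> (\<forall>F. laurent_decomposition (Tmat \<eta> r) F \<longrightarrow> F = Tcoeff \<eta> r)
   \<and> Tcoeff \<eta> r 0 = of_real \<eta> *sm
        diag (vector [of_real ((cosh r)\<^sup>2), of_real ((cosh r)\<^sup>2), of_real (cosh (2 * r))])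
   \<and> (\<forall>d. commutator Qmat (Tcoeff \<eta> r d) = of_int d *sm Tcoeff \<eta> r d)
   \<and> (\<forall>d. \<bar>d\<bar> \<ge> 3 \<longrightarrow> Tcoeff \<eta> r d = 0)
   \<and> (\<forall>d<0. axis 1 1 v* Tcoeff \<eta> r d = 0)
   \<and> axis 1 1 v* Tcoeff \<eta> r 0 = of_real x *s axis 1 1)
   \<and> ((\<forall>\<theta> i. (\<Sum>j\<in>UNIV. norm (Tmat \<eta> r \<theta> $ i $ j)) = \<rho>)
   \<and> (\<forall>\<theta>. \<exists>v. bounded_solution \<eta> r \<theta> v \<and>
        (\<forall>w. bounded_solution \<eta> r \<theta> w \<longrightarrow> (\<forall>t\<le>0. w t = v t)))
   \<and> (\<forall>\<theta> v. bounded_solution \<eta> r \<theta> v \<longrightarrow>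
        (\<forall>t\<le>0. max_norm (v t) \<le> (1 - \<eta>) / (2 * (1 - \<rho>))))
   \<and> (\<exists>C. \<forall>\<theta> \<theta>' v v' t (l::nat).
        bounded_solution \<eta> r \<theta> v \<longrightarrow> bounded_solution \<eta> r \<theta>' v' \<longrightarrow> t \<le> 0 \<longrightarrow>
        (\<forall>s. t - int l < s \<and> s \<le> t \<longrightarrow> \<theta> s = \<theta>' s) \<longrightarrow>
        max_norm (v t - v' t) \<le> C * \<rho> ^ l))
   \<and> (summable (\<lambda>l. mpow (Tcoeff \<eta> r 0) l *v b_vac \<eta>)
   \<and> (\<forall>\<theta> k. \<forall>t\<le>0. (\<lambda>js. dyson_word \<eta> r \<theta> t js *v v_zero \<eta> r) summable_on slots k t)
   \<and> (\<forall>\<theta> v. bounded_solution \<eta> r \<theta> v \<longrightarrow> (\<forall>t\<le>0. (\<lambda>k. grade \<eta> r \<theta> k t) sums v t))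
   \<and> (\<forall>k. \<exists>C. \<forall>\<^sub>F r' in at_right 0. \<forall>\<theta>. \<forall>t\<le>0.
        max_norm (grade \<eta> r' \<theta> k t) \<le> C * sigma_od \<eta> r' ^ k)
   \<and> (\<forall>\<theta>. \<forall>t\<le>0.
        ((\<lambda>j. of_real (kappa \<eta> r * x ^ nat (t - j)) * cis (\<theta> j))
          has_sum grade \<eta> r \<theta> 1 t $ 1) {..t})
   \<and> (\<forall>\<theta>. \<forall>t\<le>0.
        ((\<lambda>(i, j). of_real (\<eta> * (sinh r)\<^sup>2 * kappa \<eta> r * x ^ nat (t - j) * x ^ nat (j - 1 - i))
             * cis (2 * \<theta> j - \<theta> i))
          has_sum grade \<eta> r \<theta> 2 t $ 1) {(i, j). i < j \<and> j \<le> t}))"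
proof -
  have rho1: "\<eta> * exp (2 * r) < 1" using rho by simp
  interpret contractive_squeezing \<eta> r
    using assms(1-3) rho1 by unfold_locales
  have dec_1: "amp \<eta> r 1 1 = x" by (simp add: amp_def x)
  \<comment> \<open>Conjugation by these diagonal phases multiplies entry \<open>(i, j)\<close> by
    the phase of \<open>charge i - charge j\<close>, which is the effect of shifting the
    angle.\<close>
  have gauge_exp: "mexp ((\<i> * of_real \<phi>) *sm Qmat) = diag (\<chi> i. cis (of_int (charge i) * \<phi>))" for \<phi>
  proof -
    have "(\<i> * of_real \<phi>) *sm Qmat = diag (\<chi> i. \<i> * of_real (of_int (charge i) * \<phi>))"
      by (simp add: Qmat_eq vec_eq_iff mscale_nth diag_nth)
    then show ?thesis by (simp add: mexp_diag cis_conv_exp)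
  qed
  have gauge_exp_neg: "mexp ((- \<i> * of_real \<phi>) *sm Qmat) = diag (\<chi> i. cis (- of_int (charge i) * \<phi>))" for \<phi>
    using gauge_exp[of "- \<phi>"] by simp
  show ?thesis
  proof (intro conjI)
    show "\<forall>\<theta> \<phi>. Tmat \<eta> r (\<theta> + \<phi>) =
        mexp ((\<i> * of_real \<phi>) *sm Qmat) ** Tmat \<eta> r \<theta> ** mexp ((- \<i> * of_real \<phi>) *sm Qmat)"
      unfolding gauge_exp gauge_exp_neg
      by (simp add: vec_eq_iff mult_diag_nth diag_mult_nth Tmat_nth cis_mult algebra_simps)
    show "\<forall>\<phi>. mexp ((\<i> * of_real \<phi>) *sm Qmat) *v b_vac \<eta> = b_vac \<eta>"
      unfolding gauge_exp
      by (simp add: vec_eq_iff forall_3 diag_mult_vec_nth b_vac_def charge_def)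
    show laurent: "laurent_decomposition (Tmat \<eta> r) (Tcoeff \<eta> r)"
      using laurent_decomposition_Tmat by (simp add: Tcoeff_eq)
    show "\<forall>F. laurent_decomposition (Tmat \<eta> r) F \<longrightarrow> F = Tcoeff \<eta> r"
      using laurent laurent_decomposition_unique by blast
    show "Tcoeff \<eta> r 0 = of_real \<eta> *sm
        diag (vector [of_real ((cosh r)\<^sup>2), of_real ((cosh r)\<^sup>2), of_real (cosh (2 * r))])"
      by (simp add: Tcoeff_0_eq vec_eq_iff forall_3 diag_nth mscale_nth amp_def)
    \<comment> \<open>The commutator with a diagonal matrix scales entry \<open>(i, j)\<close> by
      \<open>charge i - charge j\<close>, which is \<open>d\<close> wherever the coefficient is
      nonzero.\<close>
    show "\<forall>d. commutator Qmat (Tcoeff \<eta> r d) = of_int d *sm Tcoeff \<eta> r d"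
      by (auto simp: commutator_def Qmat_eq vec_eq_iff mult_diag_nth diag_mult_nth mscale_nth
          Tcoeff_nth algebra_simps)
    show "\<forall>d. \<bar>d\<bar> \<ge> 3 \<longrightarrow> Tcoeff \<eta> r d = 0"
      by (auto simp: vec_eq_iff Tcoeff_nth charge_def)
    \<comment> \<open>Index 1 has the largest charge, so no charge difference in the first row is
      negative.\<close>
    show "\<forall>d<0. axis 1 1 v* Tcoeff \<eta> r d = 0"
      by (auto simp: vec_eq_iff vector_matrix_mult_def sum_3 axis_def Tcoeff_nth charge_def)
    show "axis 1 1 v* Tcoeff \<eta> r 0 = of_real x *s axis 1 1"
      by (auto simp: vec_eq_iff vector_matrix_mult_def sum_3 axis_def Tcoeff_nth charge_def dec_1)
    show "\<forall>\<theta> i. (\<Sum>j\<in>UNIV. norm (Tmat \<eta> r \<theta> $ i $ j)) = \<rho>"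
      using amp_row_sum by (simp add: Tmat_nth norm_mult rho)
    show "\<forall>\<theta>. \<exists>v. bounded_solution \<eta> r \<theta> v \<and>
        (\<forall>w. bounded_solution \<eta> r \<theta> w \<longrightarrow> (\<forall>t\<le>0. w t = v t))"
      using bounded_solution_dyson bounded_solution_unique by blast
    show "\<forall>\<theta> v. bounded_solution \<eta> r \<theta> v \<longrightarrow>
        (\<forall>t\<le>0. max_norm (v t) \<le> (1 - \<eta>) / (2 * (1 - \<rho>)))"
      unfolding rho using bounded_solution_bound by blast
    show "\<exists>C. \<forall>\<theta> \<theta>' v v' t (l::nat).
        bounded_solution \<eta> r \<theta> v \<longrightarrow> bounded_solution \<eta> r \<theta>' v' \<longrightarrow> t \<le> 0 \<longrightarrow>
        (\<forall>s. t - int l < s \<and> s \<le> t \<longrightarrow> \<theta> s = \<theta>' s) \<longrightarrow>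
        max_norm (v t - v' t) \<le> C * \<rho> ^ l"
      unfolding rho using fading_memory by blast
    show "summable (\<lambda>l. mpow (Tcoeff \<eta> r 0) l *v b_vac \<eta>)"
      using v_zero_sums by (rule sums_summable)
    show "\<forall>\<theta> k. \<forall>t\<le>0. (\<lambda>js. dyson_word \<eta> r \<theta> t js *v v_zero \<eta> r) summable_on slots k t"
      using summable_term_vec unfolding term_vec_def by blast
    show "\<forall>\<theta> v. bounded_solution \<eta> r \<theta> v \<longrightarrow> (\<forall>t\<le>0. (\<lambda>k. grade \<eta> r \<theta> k t) sums v t)"
      using bounded_solution_unique[OF bounded_solution_dyson] summable_grade
      by (simp add: sums_iff)
    show "\<forall>k. \<exists>C. \<forall>\<^sub>F r' in at_right 0. \<forall>\<theta>. \<forall>t\<le>0.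
        max_norm (grade \<eta> r' \<theta> k t) \<le> C * sigma_od \<eta> r' ^ k"
    proof
      fix k
      obtain C where "\<forall>\<^sub>F r' in at_right 0. \<forall>\<theta> t. max_norm (grade \<eta> r' \<theta> k t) \<le> C * sigma_od \<eta> r' ^ k"
        using grade_bound_sigma[OF assms(1,2)] by blast
      then show "\<exists>C. \<forall>\<^sub>F r' in at_right 0. \<forall>\<theta>. \<forall>t\<le>0.
          max_norm (grade \<eta> r' \<theta> k t) \<le> C * sigma_od \<eta> r' ^ k"
        by (intro exI[of _ C]) (auto elim: eventually_mono)
    qed
    show "\<forall>\<theta>. \<forall>t\<le>0.
        ((\<lambda>j. of_real (kappa \<eta> r * x ^ nat (t - j)) * cis (\<theta> j))
          has_sum grade \<eta> r \<theta> 1 t $ 1) {..t}"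
      using has_sum_grade_1 unfolding dec_1 by blast
    show "\<forall>\<theta>. \<forall>t\<le>0.
        ((\<lambda>(i, j). of_real (\<eta> * (sinh r)\<^sup>2 * kappa \<eta> r * x ^ nat (t - j) * x ^ nat (j - 1 - i))
             * cis (2 * \<theta> j - \<theta> i))
          has_sum grade \<eta> r \<theta> 2 t $ 1) {(i, j). i < j \<and> j \<le> t}"
      using has_sum_grade_2 unfolding dec_1 by blast
  qed
qed

end
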